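(* Let $\Phi(z)=\sum_{n\ge0}z^{2^n}$, let $\alpha$ be a positive integer, and let $C(z)=\sum_{n\ge0}\mathrm{Cat}_n z^n$ be the generating function of the Catalan numbers $\mathrm{Cat}_n=\frac1{n+1}\binom{2n}{n}$. Then $C(z)$, reduced modulo $2^{3\cdot 2^\alpha}$, can be expressed as a polynomial in $\Phi(z)$ of degree at most $2^{\alpha+2}-1$ with coefficients that are Laurent polynomials in $z$ over the integers; that is, there exist $a_i(z)\in\mathbb Z[z,z^{-1}]$, $0\le i\le 2^{\alpha+2}-1$, such that $$C(z)=\sum_{i=0}^{2^{\alpha+2}-1}a_i(z)\,\Phi^i(z)\quad\text{modulo }2^{3\cdot 2^\alpha}.$$
   Context: For formal Laurent series $f(z),g(z)$ with integer coefficients, "$f(z)=g(z)$ modulo $M$" means that the coefficients of $z^i$ in $f(z)$ and $g(z)$ agree modulo $M$ for all $i$. $\Phi^i(z)$ denotes $(\Phi(z))^i$. *)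

theory Defs
  imports
    "HOL-Computational_Algebra.Formal_Laurent_Series"
    "HOL-Number_Theory.Cong"
begin

(* The division is exact, see Suc_mult_catalan and catalan_eq_divide. *)
definition catalan :: "nat \<Rightarrow> nat" where
  "catalan n = ((2 * n) choose n) div (n + 1)"

lemma Suc_mult_catalan: "(n + 1) * catalan n = (2 * n) choose n"
proof -
  have "Suc n * ((2 * n) choose Suc n) = n * ((2 * n) choose n)"
    using binomial_absorb_comp[of "2 * n" n] binomial_absorption[of n "2 * n"]
    by (metis mult_2 add_diff_cancel_left')
  then have "Suc n * (((2 * n) choose n) - ((2 * n) choose Suc n)) = (2 * n) choose n"
    by (simp add: diff_mult_distrib2)
  then have "Suc n dvd ((2 * n) choose n)"
    by (metis dvd_triv_left)
  then show ?thesis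
    unfolding catalan_def Suc_eq_plus1 by (rule dvd_mult_div_cancel)
qed

lemma catalan_eq_divide: "real (catalan n) = 1 / real (n + 1) * real ((2 * n) choose n)"
  unfolding Suc_mult_catalan[symmetric, of n] of_nat_mult by simp

definition catalan_gf :: "int fls" where
  "catalan_gf = fps_to_fls (Abs_fps (\<lambda>n. int (catalan n)))"

(* The exponents 2^n are pairwise distinct, so the coefficients of the sum of all z^(2^n)
   are 0 or 1; Phi_fps_sums identifies Phi_fps with that sum. *)
definition Phi_fps :: "int fps" where
  "Phi_fps = Abs_fps (\<lambda>m. if \<exists>n::nat. m = 2 ^ n then 1 else 0)"

lemma Phi_fps_sums: "(\<lambda>n. fps_X ^ (2 ^ n)) sums Phi_fps"
  unfolding sums_def tendsto_fps_iff
proof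
  fix m :: nat
  have nth: "fps_nth (\<Sum>n<N. fps_X ^ (2 ^ n)) m = fps_nth Phi_fps m" if "m \<le> N" for N
  proof -
    have "fps_nth (\<Sum>n<N. fps_X ^ (2 ^ n)) m = (\<Sum>n<N. if m = 2 ^ n then 1 else 0)"
      by (simp add: fps_sum_nth fps_X_power_nth)
    also have "\<dots> = fps_nth Phi_fps m"
    proof (cases "\<exists>k::nat. m = 2 ^ k")
      case True
      then obtain k :: nat where k: "m = 2 ^ k" by blast
      have "k < N"
        using that k less_exp[of k] by linarith
      then show ?thesis
        using k by (auto simp: Phi_fps_def)
    next
      case False
      then show ?thesis by (auto simp: Phi_fps_def)
    qed
    finally show ?thesis .
  qed
  show "\<forall>\<^sub>F N in sequentially. fps_nth (\<Sum>n<N. fps_X ^ (2 ^ n)) m = fps_nth Phi_fps m"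
    using nth by (auto simp: eventually_sequentially)
qed

definition Phi :: "int fls" where
  "Phi = fps_to_fls Phi_fps"

definition laurent_polys :: "'a::zero fls set" where
  "laurent_polys = {f. finite {i. fls_nth f i \<noteq> 0}}"

definition fls_cong :: "int \<Rightarrow> int fls \<Rightarrow> int fls \<Rightarrow> bool" where
  "fls_cong M f g \<longleftrightarrow> (\<forall>i. [fls_nth f i = fls_nth g i] (mod M))"

end

theory Submission
  imports Defs
begin

(* The series D = z C(z) is the fixed point of T \<mapsto> T^2 + z without constant term, and it is
   congruent to \<Phi> modulo 2. As 2 divides D + T whenever T is congruent to D modulo 2, each
   application of T \<mapsto> T^2 + z to T = \<Phi> gains a factor of 2, so that D is a polynomial in \<Phi>
   modulo every power of 2. For the bound on the degree, write \<Phi>^2 = \<Phi> - z + 2 S; the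
   congruence between S^2 and S(z^2) modulo 2 yields a monic quartic relation for \<Phi> modulo 8.
   Its power with exponent 2^\<alpha> is a monic relation of degree 2^(\<alpha>+2) modulo 2^(3*2^\<alpha>). *)

section \<open>Spans of powers modulo an element\<close>

text \<open>\<open>L\<close> is the ring of admissible coefficients, kept abstract so that the
  reduction arguments are pure ring theory; it becomes the ring of Laurent polynomials inside the
  Laurent series.\<close>

locale unital_subring =
  fixes L :: "'a::comm_ring_1 set"
  assumes one_closed: "1 \<in> L"
    and diff_closed: "\<And>a b. a \<in> L \<Longrightarrow> b \<in> L \<Longrightarrow> a - b \<in> L"
    and mult_closed: "\<And>a b. a \<in> L \<Longrightarrow> b \<in> L \<Longrightarrow> a * b \<in> L"
begin

lemma zero_closed: "0 \<in> L"
  using diff_closed[OF one_closed one_closed] by simp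

lemma uminus_closed: "a \<in> L \<Longrightarrow> - a \<in> L"
  using diff_closed[OF zero_closed] by simp

lemma add_closed: "a \<in> L \<Longrightarrow> b \<in> L \<Longrightarrow> a + b \<in> L"
  using diff_closed[of a "- b"] uminus_closed by simp

lemma sum_closed: "(\<And>i. i \<in> A \<Longrightarrow> f i \<in> L) \<Longrightarrow> sum f A \<in> L"
  by (induction A rule: infinite_finite_induct) (auto intro: zero_closed add_closed)

lemma power_closed: "a \<in> L \<Longrightarrow> a ^ n \<in> L"
  by (induction n) (auto intro: one_closed mult_closed)

lemma of_nat_closed: "of_nat n \<in> L"
  by (induction n) (auto intro: zero_closed one_closed add_closed)

lemma numeral_closed: "numeral n \<in> L"
  using of_nat_closed[of "numeral n"] by simp

lemma coeff_mult_closed: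
  assumes "\<And>i. coeff p i \<in> L" "\<And>i. coeff q i \<in> L"
  shows "coeff (p * q) i \<in> L"
  unfolding coeff_mult using assms by (intro sum_closed mult_closed)

lemma coeff_power_closed:
  assumes "\<And>i. coeff p i \<in> L"
  shows "coeff (p ^ n) i \<in> L"
proof (induction n arbitrary: i)
  case 0
  show ?case by (simp add: coeff_1 zero_closed one_closed)
next
  case (Suc n)
  then show ?case using assms by (simp add: coeff_mult_closed)
qed

text \<open>This is the \<open>L\<close>-module generated by 1, \<open>x\<close>, ...,
  \<open>x ^ (N - 1)\<close>, enlarged by the ideal of \<open>m\<close>. The family \<open>a\<close>
  takes values in \<open>L\<close> at every index, so that no range condition has to be carried
  along.\<close>

definition spanned_mod :: "'a \<Rightarrow> 'a \<Rightarrow> nat \<Rightarrow> 'a set" where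
  "spanned_mod m x N = {f. \<exists>a. (\<forall>i. a i \<in> L) \<and> m dvd f - (\<Sum>i<N. a i * x ^ i)}"

lemma spanned_mod_dvd:
  assumes "f \<in> spanned_mod m x N" "m dvd g - f"
  shows "g \<in> spanned_mod m x N"
proof -
  obtain a where a: "\<forall>i. a i \<in> L" "m dvd f - (\<Sum>i<N. a i * x ^ i)"
    using assms by (auto simp: spanned_mod_def)
  then have "m dvd g - (\<Sum>i<N. a i * x ^ i)"
    using dvd_add[OF assms(2) a(2)] by simp
  with a show ?thesis by (auto simp: spanned_mod_def)
qed

lemma spanned_mod_add:
  assumes "f \<in> spanned_mod m x N" "g \<in> spanned_mod m x N"
  shows "f + g \<in> spanned_mod m x N"
proof -
  obtain a b where a: "\<forall>i. a i \<in> L" "m dvd f - (\<Sum>i<N. a i * x ^ i)"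
    and b: "\<forall>i. b i \<in> L" "m dvd g - (\<Sum>i<N. b i * x ^ i)"
    using assms by (auto simp: spanned_mod_def)
  have "m dvd f + g - (\<Sum>i<N. (a i + b i) * x ^ i)"
    using dvd_add[OF a(2) b(2)] by (simp add: algebra_simps sum.distrib)
  with a b show ?thesis
    unfolding spanned_mod_def by (auto intro!: exI[of _ "\<lambda>i. a i + b i"] add_closed)
qed

lemma spanned_mod_scale:
  assumes "c \<in> L" "f \<in> spanned_mod m x N"
  shows "c * f \<in> spanned_mod m x N"
proof -
  obtain a where a: "\<forall>i. a i \<in> L" "m dvd f - (\<Sum>i<N. a i * x ^ i)"
    using assms by (auto simp: spanned_mod_def)
  have "m dvd c * f - (\<Sum>i<N. (c * a i) * x ^ i)"
    using dvd_mult[OF a(2), of c] by (simp add: algebra_simps sum_distrib_left)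
  with a assms show ?thesis
    unfolding spanned_mod_def by (auto intro!: exI[of _ "\<lambda>i. c * a i"] mult_closed)
qed

lemma spanned_mod_zero: "0 \<in> spanned_mod m x N"
  unfolding spanned_mod_def by (auto intro!: exI[of _ "\<lambda>_. 0"] zero_closed)

lemma spanned_mod_sum:
  "(\<And>i. i \<in> A \<Longrightarrow> f i \<in> spanned_mod m x N) \<Longrightarrow> sum f A \<in> spanned_mod m x N"
  by (induction A rule: infinite_finite_induct) (auto intro: spanned_mod_zero spanned_mod_add)

lemma spanned_mod_power:
  assumes "k < N"
  shows "x ^ k \<in> spanned_mod m x N"
proof -
  have "(\<Sum>i<N. (if i = k then 1 else 0) * x ^ i) = (\<Sum>i<N. if i = k then x ^ i else 0)"
    by (rule sum.cong) auto
  also have "\<dots> = x ^ k"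
    using assms by simp
  finally have "m dvd x ^ k - (\<Sum>i<N. (if i = k then 1 else 0) * x ^ i)"
    by simp
  then show ?thesis
    unfolding spanned_mod_def
    by (auto intro!: exI[of _ "\<lambda>i. if i = k then 1 else 0"] zero_closed one_closed)
qed

text \<open>Once \<open>x ^ N\<close> reduces to lower powers, the span is stable under
  multiplication by \<open>x\<close>, hence by every power of \<open>x\<close> and by every
  combination of these.\<close>

lemma spanned_mod_mult:
  assumes top: "x ^ N \<in> spanned_mod m x N"
    and f: "f \<in> spanned_mod m x N" and g: "g \<in> spanned_mod m x N"
  shows "f * g \<in> spanned_mod m x N"
proof -
  have step: "x * h \<in> spanned_mod m x N" if h: "h \<in> spanned_mod m x N" for h
  proof -
    obtain a where a: "\<forall>i. a i \<in> L" "m dvd h - (\<Sum>i<N. a i * x ^ i)"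
      using h by (auto simp: spanned_mod_def)
    \<comment> \<open>Only the index \<open>i = N - 1\<close> leaves the range of allowed exponents;
      there \<open>top\<close> rewrites the power.\<close>
    have "a i * x ^ Suc i \<in> spanned_mod m x N" if "i < N" for i
      using that a(1) top by (cases "Suc i < N") (auto intro: spanned_mod_scale spanned_mod_power
          simp del: power_Suc dest: Suc_lessI)
    then have "(\<Sum>i<N. a i * x ^ Suc i) \<in> spanned_mod m x N"
      by (intro spanned_mod_sum) auto
    moreover have "m dvd x * h - (\<Sum>i<N. a i * x ^ Suc i)"
      using dvd_mult[OF a(2), of x] by (simp add: algebra_simps sum_distrib_left)
    ultimately show ?thesis by (rule spanned_mod_dvd)
  qed
  have power: "x ^ i * g \<in> spanned_mod m x N" for i
    by (induction i) (auto simp: g mult.assoc intro: step)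
  obtain a where a: "\<forall>i. a i \<in> L" "m dvd f - (\<Sum>i<N. a i * x ^ i)"
    using f by (auto simp: spanned_mod_def)
  have "(\<Sum>i<N. a i * (x ^ i * g)) \<in> spanned_mod m x N"
    by (rule spanned_mod_sum, rule spanned_mod_scale) (use a(1) power in auto)
  moreover have "m dvd f * g - (\<Sum>i<N. a i * (x ^ i * g))"
    using dvd_mult[OF a(2), of g] by (simp add: algebra_simps sum_distrib_left)
  ultimately show ?thesis by (rule spanned_mod_dvd)
qed

lemma monic_relation_spanned_mod:
  assumes "\<And>i. coeff p i \<in> L" "lead_coeff p = 1" "m dvd poly p x"
  shows "x ^ degree p \<in> spanned_mod m x (degree p)"
proof -
  let ?N = "degree p"
  have "poly p x = (\<Sum>i<?N. coeff p i * x ^ i) + x ^ ?N"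
    using assms(2) by (simp add: poly_altdef flip: lessThan_Suc_atMost)
  then have "m dvd x ^ ?N - (\<Sum>i<?N. - coeff p i * x ^ i)"
    using assms(3) by (simp add: sum_negf algebra_simps)
  with assms(1) show ?thesis
    unfolding spanned_mod_def by (auto intro!: exI[of _ "\<lambda>i. - coeff p i"] uminus_closed)
qed

end

interpretation laurent_polys: unital_subring "laurent_polys :: 'a::comm_ring_1 fls set"
proof
  show "(1 :: 'a fls) \<in> laurent_polys"
    by (simp add: laurent_polys_def)
next
  fix f g :: "'a fls"
  assume fg: "f \<in> laurent_polys" "g \<in> laurent_polys"
  let ?F = "{i. fls_nth f i \<noteq> 0}" and ?G = "{i. fls_nth g i \<noteq> 0}"
  have fin: "finite ?F" "finite ?G"
    using fg by (auto simp: laurent_polys_def)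
  have "{i. fls_nth (f - g) i \<noteq> 0} \<subseteq> ?F \<union> ?G"
    by auto
  with fin show "f - g \<in> laurent_polys"
    unfolding laurent_polys_def by (auto intro: finite_subset)
  \<comment> \<open>The support of a product lies in the sumset of the two supports.\<close>
  have "{n. fls_nth (f * g) n \<noteq> 0} \<subseteq> (\<lambda>(i, j). i + j) ` (?F \<times> ?G)"
  proof
    fix n assume "n \<in> {n. fls_nth (f * g) n \<noteq> 0}"
    then obtain i where "fls_nth f i * fls_nth g (n - i) \<noteq> 0"
      unfolding mem_Collect_eq fls_times_nth(2) by (auto elim: sum.not_neutral_contains_not_neutral)
    then have "fls_nth f i \<noteq> 0" "fls_nth g (n - i) \<noteq> 0"
      by auto
    then show "n \<in> (\<lambda>(i, j). i + j) ` (?F \<times> ?G)"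
      by (intro image_eqI[of _ _ "(i, n - i)"]) auto
  qed
  with fin show "f * g \<in> laurent_polys"
    unfolding laurent_polys_def by (auto intro: finite_subset)
qed

lemma fls_X_laurent_polys: "fls_X \<in> laurent_polys"
  by (simp add: laurent_polys_def)

lemma fls_X_inv_laurent_polys: "fls_X_inv \<in> laurent_polys"
  by (simp add: laurent_polys_def)

section \<open>Integer power series modulo 2\<close>

lemma numeral_dvd_int_fps_iff:
  fixes f :: "int fps"
  shows "numeral k dvd f \<longleftrightarrow> (\<forall>n. numeral k dvd fps_nth f n)"
proof
  assume "\<forall>n. numeral k dvd fps_nth f n"
  then have "f = numeral k * Abs_fps (\<lambda>n. fps_nth f n div numeral k)"
    by (intro fps_ext) (simp add: fps_numeral_fps_const)
  then show "numeral k dvd f" by (rule dvdI)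
qed (auto simp: fps_numeral_fps_const dvd_def)

text \<open>In the convolution for \<open>f ^ 2\<close> the terms at \<open>i\<close> and
  \<open>n - i\<close> agree, so modulo 2 only a middle term \<open>i = n - i\<close> survives. It
  is the square of a coefficient, which has the parity of that coefficient.\<close>

lemma two_dvd_square_minus_compose_square:
  fixes f :: "int fps"
  shows "2 dvd f ^ 2 - (f oo fps_X ^ 2)"
  unfolding numeral_dvd_int_fps_iff
proof
  fix n
  let ?t = "\<lambda>i. fps_nth f i * fps_nth f (n - i)"
  let ?A = "{i. 2 * i < n}" and ?B = "{i. i \<le> n \<and> n < 2 * i}" and ?C = "{i. 2 * i = n}"
  have fin: "finite ?A" "finite ?B" "finite ?C"
    by (rule finite_subset[of _ "{0..n}"]; auto)+
  have "fps_nth (f ^ 2) n = sum ?t {0..n}"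
    by (simp add: power2_eq_square fps_mult_nth)
  also have "{0..n} = ?A \<union> ?B \<union> ?C"
    by auto
  also have "sum ?t \<dots> = sum ?t ?A + sum ?t ?B + sum ?t ?C"
    using fin by (subst sum.union_disjoint; (subst sum.union_disjoint)?) auto
  \<comment> \<open>The reflection of \<open>i\<close> to \<open>n - i\<close> exchanges the two
    halves of the convolution.\<close>
  also have "sum ?t ?B = sum ?t ?A"
    by (rule sum.reindex_bij_witness[of _ "\<lambda>i. n - i" "\<lambda>i. n - i"]) auto
  finally have eq: "fps_nth (f ^ 2) n = 2 * sum ?t ?A + sum ?t ?C"
    by simp
  show "2 dvd fps_nth (f ^ 2 - (f oo fps_X ^ 2)) n"
  proof (cases "even n")
    case True
    then obtain k where k: "n = 2 * k" by blast
    then have "?C = {k}" by auto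
    with eq k show ?thesis
      by (simp add: fps_nth_compose_X_power)
  next
    case False
    then have "?C = {}" by auto
    with False eq show ?thesis
      by (simp add: fps_nth_compose_X_power)
  qed
qed

text \<open>Modulo 2, \<open>u\<close> agrees with each of its positive powers, and
  \<open>u ^ Suc n\<close> has no terms up to degree \<open>n\<close> because \<open>u\<close> has
  no constant term.\<close>

lemma two_dvd_of_two_dvd_square_minus:
  fixes u :: "int fps"
  assumes "fps_nth u 0 = 0" "2 dvd u ^ 2 - u"
  shows "2 dvd u"
  unfolding numeral_dvd_int_fps_iff
proof
  fix n
  have "2 dvd u ^ Suc k - u" for k
  proof (induction k)
    case (Suc k)
    have "u ^ Suc (Suc k) - u = u * (u ^ Suc k - u) + (u ^ 2 - u)"
      by (simp add: algebra_simps power2_eq_square)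
    then show ?case
      using dvd_add[OF dvd_mult[OF Suc] assms(2)] by (simp only:)
  qed simp
  then have "2 dvd fps_nth (u ^ Suc n - u) n"
    unfolding numeral_dvd_int_fps_iff by blast
  moreover have "fps_nth (u ^ Suc n) n = 0"
    using startsby_zero_power_prefix[OF assms(1), of "Suc n"] by blast
  ultimately show "2 dvd fps_nth u n"
    by (simp del: power_Suc)
qed

section \<open>The relation modulo 8\<close>

text \<open>Substituting z^2 for z turns the exponent 2^k into 2^(k+1), so that exactly the term z
  is lost.\<close>

lemma Phi_fps_compose_square: "Phi_fps oo fps_X ^ 2 = Phi_fps - fps_X"
proof (rule fps_ext)
  fix n :: nat
  have "(even n \<and> (\<exists>k. n div 2 = 2 ^ k)) \<longleftrightarrow> (\<exists>k. n = 2 ^ Suc k)"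
    by (auto elim!: evenE simp: power_Suc)
  moreover have "(\<exists>k. n = 2 ^ k) \<longleftrightarrow> n = 1 \<or> (\<exists>k. n = 2 ^ Suc k)"
    by (metis not0_implies_Suc power_0)
  moreover have "n \<noteq> 2 ^ Suc k" if "n = 1" for k
    using that by simp
  ultimately show "fps_nth (Phi_fps oo fps_X ^ 2) n = fps_nth (Phi_fps - fps_X) n"
    by (auto simp: fps_nth_compose_X_power Phi_fps_def fps_X_nth simp del: power_Suc)
qed

lemma Phi_fps_relation_mod_2:
  obtains S where "Phi_fps ^ 2 = Phi_fps - fps_X + 2 * S"
  using two_dvd_square_minus_compose_square[of Phi_fps]
  unfolding Phi_fps_compose_square dvd_def by (metis diff_eq_eq add.commute)

text \<open>Here \<open>E\<close> is 2 S, and the expression equals 4 (S^2 - S(z^2)), where the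
  second factor is even.\<close>

lemma Phi_fps_relation_mod_8:
  defines "E \<equiv> Phi_fps ^ 2 - Phi_fps + fps_X"
  shows "8 dvd E ^ 2 - 2 * E + 4 * fps_X * Phi_fps - 4 * fps_X ^ 2"
proof -
  obtain S where S: "Phi_fps ^ 2 = Phi_fps - fps_X + 2 * S"
    by (rule Phi_fps_relation_mod_2)
  let ?S' = "S oo fps_X ^ 2"
  have two: "(2 :: int fps) oo fps_X ^ 2 = 2"
    by (simp add: numeral_fps_const)
  have X0: "fps_nth (fps_X ^ 2 :: int fps) 0 = 0"
    by simp
  \<comment> \<open>Substituting z^2 for z in the equation for \<open>S\<close> and comparing with
    the original expresses S(z^2) exactly through \<open>S\<close> and \<open>Phi_fps\<close>, since
    2 can be cancelled.\<close>
  have "(Phi_fps oo fps_X ^ 2) ^ 2 = (Phi_fps oo fps_X ^ 2) - fps_X ^ 2 + 2 * ?S'"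
    using arg_cong[OF S, of "\<lambda>f. f oo fps_X ^ 2"]
    by (simp add: fps_compose_power fps_compose_add_distrib fps_compose_sub_distrib
        fps_compose_mult_distrib[OF X0] two)
  then have "(Phi_fps - fps_X) ^ 2 = Phi_fps - fps_X - fps_X ^ 2 + 2 * ?S'"
    unfolding Phi_fps_compose_square .
  with S have "2 * ?S' = 2 * (S - fps_X * Phi_fps + fps_X ^ 2)"
    by algebra
  then have S': "?S' = S - fps_X * Phi_fps + fps_X ^ 2"
    by (simp del: distrib_left_numeral right_diff_distrib_numeral)
  obtain W where "S ^ 2 - ?S' = 2 * W"
    using two_dvd_square_minus_compose_square[of S] by (auto simp: dvd_def)
  with S S' have "E ^ 2 - 2 * E + 4 * fps_X * Phi_fps - 4 * fps_X ^ 2 = 8 * W"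
    unfolding E_def by algebra
  then show ?thesis by (rule dvdI)
qed

section \<open>The Catalan series\<close>

text \<open>This first-order recurrence, obtained by absorption in the central binomial
  coefficients, is what gives the differential equation below.\<close>

lemma catalan_Suc: "(n + 2) * catalan (Suc n) = 2 * (2 * n + 1) * catalan n"
proof -
  have "Suc n * (2 * Suc n choose Suc n) = 2 * (Suc (2 * n) * ((2 * n) choose n))"
    using Suc_times_binomial_eq[of "2 * n" n] Suc_times_binomial_eq[of "Suc (2 * n)" n]
      binomial_symmetric[of n "Suc (2 * n)"]
    by (simp add: algebra_simps)
  also have "\<dots> = Suc n * (2 * (2 * n + 1) * catalan n)"
    unfolding Suc_mult_catalan[of n, symmetric] by (simp add: algebra_simps)
  finally have "2 * Suc n choose Suc n = 2 * (2 * n + 1) * catalan n"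
    by (simp only: mult_cancel1) simp
  then show ?thesis
    using Suc_mult_catalan[of "Suc n"] by simp
qed

definition catalan_fps :: "int fps" where
  "catalan_fps = Abs_fps (\<lambda>n. int (catalan n))"

(* Both sides solve the differential equation (1 - 4 z) H' = - 4 H with H(0) = 1. *)
lemma catalan_fps_discriminant: "(1 - 2 * fps_X * catalan_fps) ^ 2 = 1 - 4 * fps_X"
proof -
  define G where "G = 1 - 2 * fps_X * catalan_fps"
  have cat0: "catalan 0 = 1" by (simp add: catalan_def)
  have G0: "fps_nth G 0 = 1"
    by (simp add: G_def mult.assoc)
  have GSuc: "fps_nth G (Suc n) = - 2 * int (catalan n)" for n
    by (simp add: G_def mult.assoc catalan_fps_def numeral_fps_const)
  \<comment> \<open>The coefficient at \<open>Suc k\<close> is the recurrence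
    \<open>catalan_Suc\<close>, up to the factor -2.\<close>
  have G': "(1 - 4 * fps_X) * fps_deriv G = - 2 * G"
  proof (rule fps_ext)
    fix n
    show "fps_nth ((1 - 4 * fps_X) * fps_deriv G) n = fps_nth (- 2 * G) n"
    proof (cases n)
      case 0
      then show ?thesis by (simp add: GSuc G0 cat0)
    next
      case (Suc k)
      have "(int k + 2) * int (catalan (Suc k)) = 2 * (2 * int k + 1) * int (catalan k)"
        using arg_cong[OF catalan_Suc[of k], of int] by (simp add: algebra_simps)
      then show ?thesis
        using Suc
        by (simp add: left_diff_distrib mult.assoc numeral_fps_const neg_numeral_fps_const
            GSuc algebra_simps)
    qed
  qed
  define H where "H = G ^ 2"
  have "(1 - 4 * fps_X) * fps_deriv H = - 4 * H"
    using G' by (simp add: H_def fps_deriv_power power2_eq_square) algebra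
  then have "fps_nth ((1 - 4 * fps_X) * fps_deriv H) n = fps_nth (- 4 * H) n" for n
    by simp
  then have rec: "fps_nth (fps_deriv H) n - 4 * fps_nth (fps_X * fps_deriv H) n = - 4 * fps_nth H n"
    for n
    by (simp add: left_diff_distrib mult.assoc numeral_fps_const neg_numeral_fps_const)
  have H0: "fps_nth H 0 = 1"
    by (simp add: H_def G0 power2_eq_square)
  have H1: "fps_nth H 1 = - 4"
    using rec[of 0] by (simp add: H0)
  \<comment> \<open>In coefficients \<open>rec\<close> says (n+1) H_(n+1) = 4 (n-1) H_n. The factor
    n-1 vanishes at n = 1, and this kills all later coefficients.\<close>
  have H2: "fps_nth H (Suc (Suc n)) = 0" for n
  proof (induction n)
    case 0
    show ?case using rec[of 1] by (simp add: H1[unfolded One_nat_def])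
  next
    case (Suc n)
    then show ?case using rec[of "Suc (Suc n)"] by simp
  qed
  have "H = 1 - 4 * fps_X"
  proof (rule fps_ext)
    fix n
    show "fps_nth H n = fps_nth (1 - 4 * fps_X) n"
      using H0 H1 H2
      by (cases n; cases "n - 1") (auto simp: numeral_fps_const fps_X_def)
  qed
  then show ?thesis
    by (simp add: H_def G_def)
qed

text \<open>With D = z C(z), the discriminant identity (1 - 2 D)^2 = 1 - 4 z is four times this
  equation.\<close>

lemma X_catalan_fps_fixed_point:
  "(fps_X * catalan_fps) ^ 2 + fps_X = fps_X * catalan_fps"
proof -
  have "4 * ((fps_X * catalan_fps) ^ 2 + fps_X) = 4 * (fps_X * catalan_fps)"
    using catalan_fps_discriminant by algebra
  then show ?thesis
    by (simp del: distrib_left_numeral)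
qed

text \<open>Both series solve T^2 = T - z modulo 2 and squaring is additive there, so their
  difference is idempotent modulo 2; it has no constant term.\<close>

lemma X_catalan_fps_cong_Phi_fps: "2 dvd Phi_fps - fps_X * catalan_fps"
proof (rule two_dvd_of_two_dvd_square_minus)
  show "fps_nth (Phi_fps - fps_X * catalan_fps) 0 = 0"
    by (simp add: Phi_fps_def)
  obtain S where "Phi_fps ^ 2 = Phi_fps - fps_X + 2 * S"
    by (rule Phi_fps_relation_mod_2)
  then have "(Phi_fps - fps_X * catalan_fps) ^ 2 - (Phi_fps - fps_X * catalan_fps) =
      2 * (S - fps_X - Phi_fps * (fps_X * catalan_fps) + fps_X * catalan_fps)"
    using X_catalan_fps_fixed_point by algebra
  then show "2 dvd (Phi_fps - fps_X * catalan_fps) ^ 2 - (Phi_fps - fps_X * catalan_fps)"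
    by (rule dvdI)
qed

text \<open>The ring is generic because the congruence is applied in power series, while the span
  lives in Laurent series.\<close>

primrec fixed_point_iterate :: "'a::comm_ring_1 \<Rightarrow> 'a \<Rightarrow> nat \<Rightarrow> 'a" where
  "fixed_point_iterate z x 0 = x"
| "fixed_point_iterate z x (Suc n) = fixed_point_iterate z x n ^ 2 + z"

text \<open>Subtracting the equation for \<open>d\<close> leaves the product of
  \<open>?T - d\<close> and \<open>?T + d\<close>. The second factor is even because it differs from
  the first by 2 \<open>d\<close>.\<close>

lemma fixed_point_iterate_cong:
  assumes fp: "d ^ 2 + z = d" and x: "2 dvd x - d"
  shows "2 ^ Suc n dvd fixed_point_iterate z x n - d"
proof (induction n)
  case (Suc n)
  let ?T = "fixed_point_iterate z x n"
  obtain h where h: "?T - d = 2 ^ Suc n * h"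
    using Suc by (auto simp: dvd_def)
  have "?T ^ 2 + z - d = (?T - d) * (?T + d)"
    using fp by (simp add: algebra_simps power2_eq_square flip: eq_diff_eq)
  moreover have "?T + d = 2 * (d + 2 ^ n * h)"
    using h by (simp add: algebra_simps)
  ultimately have "?T ^ 2 + z - d = 2 ^ Suc (Suc n) * (h * (d + 2 ^ n * h))"
    using h by (simp only: power_Suc mult_ac)
  then show ?case
    unfolding fixed_point_iterate.simps by (rule dvdI)
qed (use x in simp)

section \<open>Reduction of the degree\<close>

lemma fls_cong_of_dvd:
  assumes "of_int M dvd f - g"
  shows "fls_cong M f g"
proof -
  obtain h where "f - g = of_int M * h"
    using assms by (auto simp: dvd_def)
  then have "fls_nth f i - fls_nth g i = M * fls_nth h i" for i
    by (simp add: fls_of_int flip: fls_minus_nth)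
  then show ?thesis
    unfolding fls_cong_def by (simp add: cong_iff_dvd_diff)
qed

lemma fps_to_fls_dvd: "f dvd g \<Longrightarrow> fps_to_fls f dvd fps_to_fls g"
  by (auto simp: dvd_def fls_times_fps_to_fls)

lemma Phi_power_spanned_mod:
  "Phi ^ (2 ^ (\<alpha> + 2)) \<in> laurent_polys.spanned_mod (2 ^ (3 * 2 ^ \<alpha>)) Phi (2 ^ (\<alpha> + 2))"
proof -
  \<comment> \<open>The expression of \<open>Phi_fps_relation_mod_8\<close>, expanded in powers of
    \<open>Phi\<close>.\<close>
  define q :: "int fls poly" where
    "q = [:- 3 * fls_X ^ 2 - 2 * fls_X, 2 + 2 * fls_X, 2 * fls_X - 1, - 2, 1:]"
  have coeffs: "coeff q i \<in> laurent_polys" for i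
    unfolding q_def
    by (auto simp: coeff_pCons split: nat.split
        intro!: laurent_polys.diff_closed laurent_polys.add_closed laurent_polys.mult_closed
          laurent_polys.power_closed laurent_polys.uminus_closed laurent_polys.numeral_closed
          laurent_polys.one_closed laurent_polys.zero_closed fls_X_laurent_polys)
  have deg: "degree q = 4" and lead: "lead_coeff q = 1" and nz: "q \<noteq> 0"
    by (simp_all add: q_def)
  have "8 dvd poly q Phi"
    using fps_to_fls_dvd[OF Phi_fps_relation_mod_8]
    by (simp add: q_def Phi_def fls_times_fps_to_fls fps_to_fls_power algebra_simps
        power2_eq_square)
  then have "8 ^ 2 ^ \<alpha> dvd poly (q ^ 2 ^ \<alpha>) Phi"
    by (simp add: poly_power dvd_power_same)
  moreover have "(8 :: int fls) ^ 2 ^ \<alpha> = 2 ^ (3 * 2 ^ \<alpha>)"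
    by (simp add: power_mult)
  moreover have "degree (q ^ 2 ^ \<alpha>) = 2 ^ (\<alpha> + 2)"
    using nz deg by (simp add: degree_power_eq power_add)
  moreover have "lead_coeff (q ^ 2 ^ \<alpha>) = 1"
    using lead by (simp only: lead_coeff_power power_one)
  ultimately show ?thesis
    using laurent_polys.monic_relation_spanned_mod[of "q ^ 2 ^ \<alpha>" "2 ^ (3 * 2 ^ \<alpha>)" Phi]
      laurent_polys.coeff_power_closed[of q] coeffs
    by simp
qed

lemma fps_to_fls_fixed_point_iterate:
  "fps_to_fls (fixed_point_iterate z x n) = fixed_point_iterate (fps_to_fls z) (fps_to_fls x) n"
  by (induction n) (simp_all add: fps_to_fls_power)

lemma catalan_gf_spanned_mod:
  "catalan_gf \<in> laurent_polys.spanned_mod (2 ^ (3 * 2 ^ \<alpha>)) Phi (2 ^ (\<alpha> + 2))"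
proof -
  let ?m = "2 ^ (3 * 2 ^ \<alpha>) :: int fls" and ?N = "2 ^ (\<alpha> + 2) :: nat"
  let ?M = "laurent_polys.spanned_mod ?m Phi ?N"
  let ?T = "fixed_point_iterate fls_X Phi"
  have N: "1 < ?N"
    by (rule one_less_power) auto
  have X: "fls_X \<in> ?M"
    using laurent_polys.spanned_mod_scale[OF fls_X_laurent_polys
        laurent_polys.spanned_mod_power[of 0 ?N Phi ?m]] N by simp
  \<comment> \<open>By \<open>Phi_power_spanned_mod\<close> the span is closed under products, so
    squaring and adding z stay inside it.\<close>
  have T: "?T n \<in> ?M" for n
  proof (induction n)
    case 0
    show ?case
      using laurent_polys.spanned_mod_power[OF N, of Phi ?m] by simp
  next
    case (Suc n)
    then show ?case
      using X Phi_power_spanned_mod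
      by (auto simp: power2_eq_square
          intro!: laurent_polys.spanned_mod_add laurent_polys.spanned_mod_mult)
  qed
  \<comment> \<open>This many iterations already give the modulus 2^(k+1), one factor of 2 more than
    required.\<close>
  let ?k = "3 * 2 ^ \<alpha> :: nat"
  have "(2 :: int fps) ^ ?k dvd 2 ^ Suc ?k"
    by (rule le_imp_power_dvd) simp
  also have "\<dots> dvd fixed_point_iterate fps_X Phi_fps ?k - fps_X * catalan_fps"
    by (rule fixed_point_iterate_cong[OF X_catalan_fps_fixed_point X_catalan_fps_cong_Phi_fps])
  finally have "?m dvd ?T ?k - fls_X * catalan_gf"
    using fps_to_fls_dvd
    by (fastforce simp: fps_to_fls_fixed_point_iterate Phi_def fls_times_fps_to_fls
        fps_to_fls_power catalan_gf_def catalan_fps_def)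
  \<comment> \<open>Passing from z C(z) to C(z) costs a division by z; it stays among the
    coefficients since 1/z is a Laurent polynomial.\<close>
  then have "?m dvd fls_X_inv * (fls_X * catalan_gf - ?T ?k)"
    by (metis dvd_mult dvd_minus_iff minus_diff_eq)
  moreover have "fls_X_inv * (fls_X * catalan_gf) = catalan_gf"
    by (simp add: fls_X_inv_times_conv_shift fls_X_times_conv_shift)
  ultimately have "?m dvd catalan_gf - fls_X_inv * ?T ?k"
    by (simp add: right_diff_distrib)
  then show ?thesis
    using laurent_polys.spanned_mod_scale[OF fls_X_inv_laurent_polys T]
    by (rule laurent_polys.spanned_mod_dvd[rotated])
qed

theorem theorem13:
  fixes \<alpha> :: nat
  assumes "\<alpha> > 0"
  shows "\<exists>a :: nat \<Rightarrow> int fls.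
           (\<forall>i \<in> {0..2 ^ (\<alpha> + 2) - 1}. a i \<in> laurent_polys) \<and>
           fls_cong (2 ^ (3 * 2 ^ \<alpha>)) catalan_gf
             (\<Sum>i = 0..2 ^ (\<alpha> + 2) - 1. a i * Phi ^ i)"
proof -
  obtain a where a: "\<forall>i. a i \<in> laurent_polys"
    "2 ^ (3 * 2 ^ \<alpha>) dvd catalan_gf - (\<Sum>i<2 ^ (\<alpha> + 2). a i * Phi ^ i)"
    using catalan_gf_spanned_mod by (auto simp: laurent_polys.spanned_mod_def)
  have "{..<2 ^ (\<alpha> + 2)} = {0..2 ^ (\<alpha> + 2) - 1 :: nat}"
    by (auto simp: less_eq_Suc_le Suc_le_eq le_diff_conv2 simp flip: less_eq_Suc_le)
  with a(2) have "fls_cong (2 ^ (3 * 2 ^ \<alpha>)) catalan_gf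
      (\<Sum>i = 0..2 ^ (\<alpha> + 2) - 1. a i * Phi ^ i)"
    by (intro fls_cong_of_dvd) simp
  with a(1) show ?thesis by blast
qed

end
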